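(* Let $X_1, X_2, \dots, X_n$ be $n$ independent real random variables with $\mathbb{E}[X_i] = 0$ and $X_i \ge -1$ for each $i$, and let $X = \sum_{i=1}^n X_i$. Then $$\text{Prob}[X \le 1] \ge 0.1541.$$
   Context: $\text{Prob}$ denotes probability and $\mathbb{E}$ denotes expectation. The number $n$ of random variables is an arbitrary positive integer, and the random variables are not assumed to be identically distributed. *)

theory Defs
  imports "HOL-Probability.Probability"
begin

end

theory Submission
  imports Defs
begin

text \<open>
  Rescale to $U_i = e X_i \ge -e$. The sum of the expectations of $\min(U_i^2, |U_i|)$ is continuous
  in $e$ and vanishes at $0$, so $e \in (0, 2/5]$ can be chosen such that it equals $4/3$, unless it
  stays below $4/3$ up to $e = 2/5$. Condition on all $U_i$ being at most $1$. This moves the mean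
  of the sum to some $-d \le 0$, and the conditioning event has probability at least $\exp(-d)$.
  Let $S$ be the recentred conditioned sum, with variance $v$. The choice of $e$ ties $v$ to $4/3 - d$, and the
  bounds $-e \le U_i \le 1$ control the fourth moment of $S$ by its second and third moments.
  The quartic $-y(y-2)^2(y+3)/32$ lies below the indicator of $y \le 0$. Its expectation at
  $y = S - d - e$ is therefore a lower bound for the conditional probability, and a polynomial
  inequality in $d$, $e$ and $v$ shows that this expectation is at least $\exp(d)/6$. The sum
  of the $X_i$ is thus at most $1$ with probability at least $1/6$.
\<close>

section \<open>Polynomial inequalities in the mean shift, the scale and the variance\<close>

text \<open>
  A lower bound for 32 times the expectation of $-y(y-2)^2(y+3)/32$ at $y = S - (d + e)$, where
  $S$ is the recentred conditioned sum; the last term accounts for the third and fourth cumulants.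
\<close>

definition quartic_bound :: "real \<Rightarrow> real \<Rightarrow> real \<Rightarrow> real" where
  "quartic_bound d e v = 8 * v - 3 * v^2 - 3 * v * (d + e) - 6 * v * (d + e)^2 + 12 * (d + e) + 8 * (d + e)^2
     - (d + e)^3 - (d + e)^4 - v * e * (1 + 4 * (d + e) + e)"

text \<open>
  The right-hand sides below are expansions in the Bernstein basis in $s = 3d/4$ and $r = 5e/2$;
  all their coefficients are nonnegative.
\<close>

lemma quartic_bound_lower:
  fixes s r :: real
  assumes "0 \<le> s" "s \<le> 1" "0 \<le> r" "r \<le> 1"
  shows "quartic_bound (4/3 * s) (2/5 * r) (4/3 - 4/3 * s - 2/5 * r * (4/3 * s))
    \<ge> 16/3 * (1 + (4/3 * s)/2 + ((4/3 * s)/2)^2)^2"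
proof -
  \<comment> \<open>The factor 151875 = 3^5 * 5^4 clears the denominators:
    \<open>d = 4/3 * s\<close> and \<open>e = 2/5 * r\<close> enter up to the fourth power, and 16/3
    adds one more 3.\<close>
  have "151875 * (quartic_bound (4/3 * s) (2/5 * r) (4/3 - 4/3 * s - 2/5 * r * (4/3 * s))
      - 16/3 * (1 + (4/3 * s)/2 + ((4/3 * s)/2)^2)^2) =
         (1-s)^4 * (405000 * r * (1-r)^3 + 1053000 * r^2 * (1-r)^2 + 881280 * r^3 * (1-r) + 229392 * r^4) +
         s * (1-s)^3 * (540000 * (1-r)^4 + 3672000 * r * (1-r)^3 + 7516800 * r^2 * (1-r)^2 + 6229440 * r^3 * (1-r) + 1829088 * r^4) +
         s^2 * (1-s)^2 * (540000 * (1-r)^4 + 5346000 * r * (1-r)^3 + 13294800 * r^2 * (1-r)^2 + 12925440 * r^3 * (1-r) + 4413312 * r^4) +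
         s^3 * (1-s) * (780000 * (1-r)^4 + 6864000 * r * (1-r)^3 + 17035200 * r^2 * (1-r)^2 + 16831680 * r^3 * (1-r) + 5864928 * r^4) +
         s^4 * (140000 * (1-r)^4 + 2225000 * r * (1-r)^3 + 6364200 * r^2 * (1-r)^2 + 6694400 * r^3 * (1-r) + 2411312 * r^4)"
    unfolding quartic_bound_def by algebra
  also have "\<dots> \<ge> 0"
    using assms by (intro add_nonneg_nonneg mult_nonneg_nonneg zero_le_power) simp_all
  finally show ?thesis by simp
qed

text \<open>The third argument is the largest variance that \<open>quartic_bound_ge\<close> admits.
  The right-hand side is a polynomial majorant of \<open>16/3 * exp d\<close>.\<close>

lemma quartic_bound_upper:
  fixes s r :: real
  assumes "0 \<le> s" "s \<le> 1" "0 \<le> r" "r \<le> 1"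
  shows "quartic_bound (4/3 * s) (2/5 * r) ((4/3 - 4/3 * s) * (1 + 3/2 * (2/5 * r) * (4/3 * s)))
    \<ge> 16/3 * (1 + (4/3 * s)/2 + ((4/3 * s)/2)^2)^2"
proof -
  have "151875 * (quartic_bound (4/3 * s) (2/5 * r) ((4/3 - 4/3 * s) * (1 + 3/2 * (2/5 * r) * (4/3 * s)))
      - 16/3 * (1 + (4/3 * s)/2 + ((4/3 * s)/2)^2)^2) =
         (1-s)^4 * (405000 * r * (1-r)^3 + 1053000 * r^2 * (1-r)^2 + 881280 * r^3 * (1-r) + 229392 * r^4) +
         s * (1-s)^3 * (540000 * (1-r)^4 + 3672000 * r * (1-r)^3 + 7128000 * r^2 * (1-r)^2 + 5024160 * r^3 * (1-r) + 1012608 * r^4) +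
         s^2 * (1-s)^2 * (540000 * (1-r)^4 + 6318000 * r * (1-r)^3 + 12841200 * r^2 * (1-r)^2 + 8104320 * r^3 * (1-r) + 1017792 * r^4) +
         s^3 * (1-s) * (780000 * (1-r)^4 + 5568000 * r * (1-r)^3 + 9993600 * r^2 * (1-r)^2 + 5923680 * r^3 * (1-r) + 702528 * r^4) +
         s^4 * (140000 * (1-r)^4 + 1685000 * r * (1-r)^3 + 4053000 * r^2 * (1-r)^2 + 3549440 * r^3 * (1-r) + 1037552 * r^4)"
    unfolding quartic_bound_def by algebra
  also have "\<dots> \<ge> 0"
    using assms by (intro add_nonneg_nonneg mult_nonneg_nonneg zero_le_power) simp_all
  finally show ?thesis by simp
qed

text \<open>At the maximal scale \<open>e = 2/5\<close> the variance may be arbitrarily small, so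
  \<open>v = 0\<close> is the lower end to check there.\<close>

lemma quartic_bound_zero:
  fixes s :: real
  assumes "0 \<le> s" "s \<le> 1"
  shows "quartic_bound (4/3 * s) (2/5) (0)
    \<ge> 16/3 * (1 + (4/3 * s)/2 + ((4/3 * s)/2)^2)^2"
proof -
  have "quartic_bound (4/3 * s) (2/5) 0 = 12 * (4/3 * s + 2/5) + 8 * (4/3 * s + 2/5)^2
          - (4/3 * s + 2/5)^3 - (4/3 * s + 2/5)^4"
    unfolding quartic_bound_def by simp
  then have "151875 * (quartic_bound (4/3 * s) (2/5) (0)
      - 16/3 * (1 + (4/3 * s)/2 + ((4/3 * s)/2)^2)^2) =
         (1-s)^4 * 99792 +
         s * (1-s)^3 * 2896128 +
         s^2 * (1-s)^2 * 8586432 +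
         s^3 * (1-s) * 7467648 +
         s^4 * 1037552"
    by algebra
  also have "\<dots> \<ge> 0"
    using assms by (intro add_nonneg_nonneg mult_nonneg_nonneg zero_le_power) simp_all
  finally show ?thesis by simp
qed

section \<open>Moments of a single truncated variable\<close>

text \<open>
  $d$ is minus the mean of $U$ conditioned on $-e \le U \le 1$, and $m_k$ is the $k$-th central
  moment of this conditional law.
\<close>

lemma (in prob_space) truncated_moments:
  fixes U :: "'a \<Rightarrow> real" and e :: real
  assumes int [simp]: "integrable M U" and mean: "expectation U = 0"
    and lower: "AE \<omega> in M. - e \<le> U \<omega>" and e: "0 < e" "e \<le> 1"
  defines "w \<equiv> \<lambda>\<omega>. indicator {-e..1} (U \<omega>) :: real"
  defines "p \<equiv> expectation w"
  defines "d \<equiv> - expectation (\<lambda>\<omega>. w \<omega> * U \<omega>) / p"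
  defines "m \<equiv> \<lambda>k. expectation (\<lambda>\<omega>. (w \<omega> * (U \<omega> + d)) ^ k) / p"
  defines "t \<equiv> expectation (\<lambda>\<omega>. min ((U \<omega>)\<^sup>2) \<bar>U \<omega>\<bar>)"
  shows "0 < p" and "1 \<le> p * (1 + d)" and "0 \<le> d" and "d \<le> e"
    and "expectation (\<lambda>\<omega>. w \<omega> * (U \<omega> + d)) = 0" and "0 \<le> m 2"
    and "t \<le> m 2 + d + e * d" and "m 2 \<le> t - d + e * d" and "m 2 \<le> (1 + e) * (t - d)"
    and "\<And>h. 0 \<le> h \<Longrightarrow> m 4 \<le> (1 + 4 * h) * m 3 + e * (1 + 4 * h + e) * m 2"
proof -
  have [measurable]: "U \<in> borel_measurable M"
    using int by (rule borel_measurable_integrable)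
  have w_cases: "w \<omega> = 0 \<and> (U \<omega> < -e \<or> 1 < U \<omega>) \<or> w \<omega> = 1 \<and> -e \<le> U \<omega> \<and> U \<omega> \<le> 1" for \<omega>
    unfolding w_def by (auto simp: indicator_def)
  have w_eq: "w \<omega> = (if -e \<le> U \<omega> \<and> U \<omega> \<le> 1 then 1 else 0)" for \<omega>
    unfolding w_def by (simp add: indicator_def)
  have [measurable]: "w \<in> borel_measurable M"
    unfolding w_def by measurable
  have wU: "\<bar>w \<omega> * (U \<omega> + c)\<bar> \<le> 1 + \<bar>c\<bar>" for \<omega> c
    using w_cases[of \<omega>] e by auto
  have int_power [simp]: "integrable M (\<lambda>\<omega>. (w \<omega> * (U \<omega> + c)) ^ k)" for c k
    by (rule integrable_const_bound[where B = "(1 + \<bar>c\<bar>) ^ k"])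
       (auto simp: power_abs intro!: power_mono wU)
  have [simp]: "integrable M (\<lambda>\<omega>. w \<omega> * (U \<omega> + c))" for c
    by (rule integrable_const_bound[where B = "1 + \<bar>c\<bar>"]) (auto intro: wU)
  from this[of 0] have [simp]: "integrable M (\<lambda>\<omega>. w \<omega> * U \<omega>)" by simp
  have [simp]: "integrable M w"
    by (rule integrable_const_bound[where B = 1]) (auto simp: w_def indicator_def)
  from int_power[of 0 2] have [simp]: "integrable M (\<lambda>\<omega>. (w \<omega> * U \<omega>) ^ 2)" by simp
  define a b where "a = expectation (\<lambda>\<omega>. w \<omega> * U \<omega>)"
    and "b = expectation (\<lambda>\<omega>. (w \<omega> * U \<omega>)\<^sup>2)"

  \<comment> \<open>Truncation discards, up to null sets, only points with \<open>U > 1\<close>,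
    where \<open>1 - U\<close> is negative, so it cannot lower the mean of
    \<open>1 - U\<close>.\<close>
  have "expectation (\<lambda>\<omega>. 1 - U \<omega>) \<le> expectation (\<lambda>\<omega>. w \<omega> - w \<omega> * U \<omega>)"
    by (rule integral_mono_AE, simp, simp) (use lower in \<open>auto elim!: eventually_mono simp: w_eq\<close>)
  then have p_a: "1 \<le> p - a"
    by (simp add: mean p_def a_def prob_space)
  have "expectation (\<lambda>\<omega>. w \<omega> * U \<omega>) \<le> expectation U"
    by (rule integral_mono_AE, simp, simp) (use lower in \<open>auto elim!: eventually_mono simp: w_eq\<close>)
  then have a_le: "a \<le> 0" by (simp add: mean a_def)
  have "expectation (\<lambda>\<omega>. - e * w \<omega>) \<le> expectation (\<lambda>\<omega>. w \<omega> * U \<omega>)"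
    by (rule integral_mono_AE, simp, simp) (simp_all add: w_eq)
  then have a_ge: "- e * p \<le> a" by (simp add: p_def a_def)
  have "expectation w \<le> expectation (\<lambda>\<omega>. 1)"
    by (rule integral_mono_AE, simp, simp) (simp_all add: w_eq)
  then have p_le: "p \<le> 1" by (simp add: p_def prob_space)
  \<comment> \<open>Since \<open>d\<close> is defined by a division by \<open>p\<close>, positivity
    comes first, from \<open>1 <= p - a <= p * (1 + e)\<close>.\<close>
  have "0 < p * (1 + e)" using p_a a_ge by (simp add: algebra_simps)
  then show p: "0 < p" using e by (simp add: zero_less_mult_iff)
  have pd: "p * d = - a" using p by (simp add: d_def a_def)
  show pd1: "1 \<le> p * (1 + d)" using p_a pd by (simp add: algebra_simps)
  have "0 \<le> p * d" using pd a_le by simp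
  then show d: "0 \<le> d" using p by (simp add: zero_le_mult_iff)
  have "p * d \<le> p * e" using a_ge pd by (simp add: algebra_simps)
  then show de: "d \<le> e" using p by simp
  have "expectation (\<lambda>\<omega>. w \<omega> * (U \<omega> + d)) = expectation (\<lambda>\<omega>. w \<omega> * U \<omega> + d * w \<omega>)"
    by (simp add: algebra_simps)
  also have "\<dots> = a + d * p" by (simp add: a_def p_def)
  also have "\<dots> = 0" using pd by (simp add: mult.commute)
  finally show "expectation (\<lambda>\<omega>. w \<omega> * (U \<omega> + d)) = 0" .

  have "expectation (\<lambda>\<omega>. (w \<omega> * (U \<omega> + d)) ^ 2)
      = expectation (\<lambda>\<omega>. (w \<omega> * U \<omega>)\<^sup>2 + 2 * d * (w \<omega> * U \<omega>) + d\<^sup>2 * w \<omega>)"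
  proof (rule Bochner_Integration.integral_cong)
    fix \<omega>
    show "(w \<omega> * (U \<omega> + d)) ^ 2 = (w \<omega> * U \<omega>)\<^sup>2 + 2 * d * (w \<omega> * U \<omega>) + d\<^sup>2 * w \<omega>"
      using w_cases[of \<omega>] by (auto simp: power2_eq_square algebra_simps)
  qed simp
  also have "\<dots> = b + 2 * d * a + d\<^sup>2 * p"
    by (simp add: a_def b_def p_def)
  finally have m2: "p * m 2 = b + 2 * d * a + d\<^sup>2 * p"
    using p by (simp add: m_def)
  show m2_nonneg: "0 \<le> m 2" using p by (simp add: m_def)
  \<comment> \<open>Almost surely \<open>U\<close> lies in \<open>[-e, 1]\<close>, where the minimum
    is the square because \<open>e <= 1\<close>, or above 1, where it is \<open>U\<close> itself.
    With mean zero this yields \<open>t = b - a\<close>.\<close>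
  have "t = expectation (\<lambda>\<omega>. (w \<omega> * U \<omega>)\<^sup>2 + (U \<omega> - w \<omega> * U \<omega>))"
    unfolding t_def
  proof (rule integral_cong_AE)
    show "AE \<omega> in M. min ((U \<omega>)\<^sup>2) \<bar>U \<omega>\<bar> = (w \<omega> * U \<omega>)\<^sup>2 + (U \<omega> - w \<omega> * U \<omega>)"
      using lower
    proof eventually_elim
      case (elim \<omega>)
      show ?case
      proof (cases "U \<omega> \<le> 1")
        case True
        then have "\<bar>U \<omega>\<bar> * \<bar>U \<omega>\<bar> \<le> \<bar>U \<omega>\<bar> * 1"
          using elim e by (intro mult_left_mono) auto
        then show ?thesis using True elim by (auto simp: w_def power2_eq_square min_def)
      next
        case False
        then have "U \<omega> * 1 \<le> U \<omega> * U \<omega>" by (intro mult_left_mono) auto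
        then show ?thesis using False by (auto simp: w_def power2_eq_square min_def)
      qed
    qed
  qed simp_all
  also have "\<dots> = b - a" by (simp add: a_def b_def mean)
  finally have t_ba: "t = b - a" .
  then have t: "t = p * (m 2 + d + d\<^sup>2)"
    using m2 pd by (simp add: algebra_simps power2_eq_square)
  \<comment> \<open>This integrates \<open>(1 - U) * (U + e) >= 0\<close> over the window
    \<open>[-e, 1]\<close>.\<close>
  have "b \<le> expectation (\<lambda>\<omega>. (1 - e) * (w \<omega> * U \<omega>) + e * w \<omega>)"
    unfolding b_def
  proof (rule integral_mono)
    fix \<omega>
    have "0 \<le> w \<omega> * ((1 - U \<omega>) * (U \<omega> + e))"
      using w_cases[of \<omega>] by auto
    then show "(w \<omega> * U \<omega>)\<^sup>2 \<le> (1 - e) * (w \<omega> * U \<omega>) + e * w \<omega>"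
      using w_cases[of \<omega>] by (auto simp: power2_eq_square algebra_simps)
  qed simp_all
  also have "\<dots> = (1 - e) * a + e * p" by (simp add: a_def p_def)
  finally have "t \<le> e * (p * (1 + d))" using t_ba pd by (simp add: algebra_simps)
  then have "p * (m 2 + d + d\<^sup>2) \<le> p * (e * (1 + d))" using t by (simp add: algebra_simps)
  then have v_le: "m 2 + d + d\<^sup>2 \<le> e * (1 + d)" using p by simp
  have dd: "d * d \<le> e * d" using d de by (rule_tac mult_right_mono) auto
  have sum0: "0 \<le> m 2 + d + d\<^sup>2" using m2_nonneg d by simp
  have "t \<le> 1 * (m 2 + d + d\<^sup>2)"
    unfolding t using p_le sum0 by (intro mult_right_mono) auto
  then show "t \<le> m 2 + d + e * d" using dd by (simp add: power2_eq_square)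
  \<comment> \<open>Passing from \<open>t\<close> to \<open>t / p = m 2 + d + d^2\<close> costs a
    \<open>1 - p\<close> share of the latter, which is small because \<open>p * (1 + d) >= 1\<close>
    gives \<open>(1 - p) * (1 + d) <= d\<close>.\<close>
  have "(1 - p) * (m 2 + d + d\<^sup>2) \<le> (1 - p) * (e * (1 + d))"
    using v_le p_le by (intro mult_left_mono) auto
  moreover have "e * ((1 - p) * (1 + d)) \<le> e * d"
    using pd1 e by (intro mult_left_mono) (auto simp: algebra_simps)
  ultimately show "m 2 \<le> t - d + e * d"
    using t by (simp add: algebra_simps) (smt (verit) zero_le_square power2_eq_square)
  \<comment> \<open>A second upper bound for the variance begins here; it beats the previous one
    when \<open>2 * d > t\<close>.\<close>
  have "m 2 + d + d\<^sup>2 \<le> (p * (1 + d)) * (m 2 + d + d\<^sup>2)"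
    using mult_right_mono[OF pd1 sum0] by simp
  then have "m 2 + d * (1 + d) \<le> t * (1 + d)"
    unfolding t by (simp add: algebra_simps power2_eq_square)
  then have *: "m 2 \<le> (1 + d) * (t - d)" by (simp add: algebra_simps)
  then have "0 \<le> (1 + d) * (t - d)" using m2_nonneg by linarith
  then have "0 \<le> t - d" using d by (simp add: zero_le_mult_iff)
  then have "(1 + d) * (t - d) \<le> (1 + e) * (t - d)" using de by (intro mult_right_mono) auto
  with * show "m 2 \<le> (1 + e) * (t - d)" by linarith

  have Em: "expectation (\<lambda>\<omega>. (w \<omega> * (U \<omega> + d)) ^ k) = p * m k" for k
    using p by (simp add: m_def)
  fix h :: real assume h: "0 \<le> h"
  let ?z = "\<lambda>\<omega>. w \<omega> * (U \<omega> + d)"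
  \<comment> \<open>The values of \<open>?z\<close> lie in \<open>[-e, 1 + 4 * h + e]\<close>, and
    the product of the distances to both ends, times \<open>?z^2\<close>, is nonnegative. The
    parameter \<open>h\<close> stays free so that the factor of \<open>m 3\<close> can later match
    the cubic coefficient of the quartic.\<close>
  have "0 \<le> expectation (\<lambda>\<omega>. (1 + 4 * h) * ?z \<omega> ^ 3 + e * (1 + 4 * h + e) * ?z \<omega> ^ 2 - ?z \<omega> ^ 4)"
  proof (rule integral_nonneg_AE, rule AE_I2)
    fix \<omega>
    have "-e \<le> ?z \<omega>" "?z \<omega> \<le> 1 + 4 * h + e"
      using w_cases[of \<omega>] d de h e by auto
    then have "0 \<le> (?z \<omega>)\<^sup>2 * ((?z \<omega> + e) * (1 + 4 * h + e - ?z \<omega>))"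
      by (intro mult_nonneg_nonneg) auto
    also have "\<dots> = (1 + 4 * h) * ?z \<omega> ^ 3 + e * (1 + 4 * h + e) * ?z \<omega> ^ 2 - ?z \<omega> ^ 4"
      by algebra
    finally show "0 \<le> (1 + 4 * h) * ?z \<omega> ^ 3 + e * (1 + 4 * h + e) * ?z \<omega> ^ 2 - ?z \<omega> ^ 4" .
  qed
  also have "\<dots> = (1 + 4 * h) * (p * m 3) + e * (1 + 4 * h + e) * (p * m 2) - p * m 4"
    by (simp add: Em)
  also have "\<dots> = p * ((1 + 4 * h) * m 3 + e * (1 + 4 * h + e) * m 2 - m 4)"
    by (simp add: algebra_simps)
  finally show "m 4 \<le> (1 + 4 * h) * m 3 + e * (1 + 4 * h + e) * m 2"
    using p by (simp add: zero_le_mult_iff)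
qed

section \<open>Moments of the sum under the truncation weight\<close>

text \<open>With indicators for \<open>f\<close>, dividing by the product of the \<open>p i\<close>
  gives moments of a sum of independent centred variables under the conditional law. Second and
  third moments add; the fourth also gains \<open>3 * (V^2 - sum of (m i 2)^2)\<close>, where
  \<open>V\<close> is the total variance, and the negative part is dropped. Weights avoid a change
  of measure.\<close>

lemma (in prob_space) weighted_sum_moments:
  fixes X :: "'i \<Rightarrow> 'a \<Rightarrow> real" and f g :: "'i \<Rightarrow> real \<Rightarrow> real"
  assumes "finite I" and "indep_vars (\<lambda>_. borel) X I"
    and f [measurable]: "\<And>i. f i \<in> borel_measurable borel"
    and g [measurable]: "\<And>i. g i \<in> borel_measurable borel"
    and f_bound: "\<And>i x. \<bar>f i x\<bar> \<le> 1" and g_bound: "\<And>i x. \<bar>g i x\<bar> \<le> B i"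
    and fg: "\<And>i x. f i x * g i x = g i x"
    and Ef: "\<And>i. i \<in> I \<Longrightarrow> expectation (\<lambda>\<omega>. f i (X i \<omega>)) = p i"
    and p_nonneg: "\<And>i. i \<in> I \<Longrightarrow> 0 \<le> p i"
    and Eg: "\<And>i. i \<in> I \<Longrightarrow> expectation (\<lambda>\<omega>. g i (X i \<omega>)) = 0"
    and Eg_power: "\<And>i k. i \<in> I \<Longrightarrow> expectation (\<lambda>\<omega>. g i (X i \<omega>) ^ k) = p i * m i k"
  defines "W \<equiv> \<lambda>I \<omega>. \<Prod>i\<in>I. f i (X i \<omega>)" and "S \<equiv> \<lambda>I \<omega>. \<Sum>i\<in>I. g i (X i \<omega>)"
  shows "(\<forall>k. integrable M (\<lambda>\<omega>. W I \<omega> * S I \<omega> ^ k)) \<and>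
    expectation (W I) = (\<Prod>i\<in>I. p i) \<and>
    expectation (\<lambda>\<omega>. W I \<omega> * S I \<omega>) = 0 \<and>
    expectation (\<lambda>\<omega>. W I \<omega> * S I \<omega> ^ 2) = (\<Prod>i\<in>I. p i) * (\<Sum>i\<in>I. m i 2) \<and>
    expectation (\<lambda>\<omega>. W I \<omega> * S I \<omega> ^ 3) = (\<Prod>i\<in>I. p i) * (\<Sum>i\<in>I. m i 3) \<and>
    expectation (\<lambda>\<omega>. W I \<omega> * S I \<omega> ^ 4)
      \<le> (\<Prod>i\<in>I. p i) * ((\<Sum>i\<in>I. m i 4) + 3 * (\<Sum>i\<in>I. m i 2)\<^sup>2)"
  using assms(1,2) Ef p_nonneg Eg Eg_power
proof (induction I rule: finite_induct)
  case empty
  then show ?case by (simp add: W_def S_def prob_space)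
next
  case (insert i I)
  define P V C Q where "P = (\<Prod>i\<in>I. p i)" and "V = (\<Sum>i\<in>I. m i 2)"
    and "C = (\<Sum>i\<in>I. m i 3)" and "Q = (\<Sum>i\<in>I. m i 4)"
  define A where "A k \<omega> = W I \<omega> * S I \<omega> ^ k" for k \<omega>
  let ?w = "\<lambda>\<omega>. f i (X i \<omega>)" and ?z = "\<lambda>\<omega>. g i (X i \<omega>)"
  have "indep_vars (\<lambda>_. borel) X I"
    using insert.prems(1) by (rule indep_vars_subset) auto
  then have IH: "(\<forall>k. integrable M (A k)) \<and> expectation (A 0) = P \<and> expectation (A 1) = 0 \<and>
      expectation (A 2) = P * V \<and> expectation (A 3) = P * C \<and>
      expectation (A 4) \<le> P * (Q + 3 * V\<^sup>2)"
    using insert.IH insert.prems unfolding A_def [abs_def] P_def V_def C_def Q_def by simp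
  have P_nonneg: "0 \<le> P"
    unfolding P_def using insert.prems by (intro prod_nonneg) auto
  have [measurable]: "X j \<in> borel_measurable M" if "j \<in> insert i I" for j
    using insert.prems(1) that unfolding indep_vars_def by auto
  then have [measurable]: "X i \<in> borel_measurable M" by simp
  have int_f: "integrable M ?w"
    by (rule integrable_const_bound[where B = 1]) (simp_all add: f_bound)
  have int_g: "integrable M (\<lambda>\<omega>. ?z \<omega> ^ k)" for k
    by (rule integrable_const_bound[where B = "B i ^ k"])
       (auto simp: power_abs intro!: power_mono g_bound)
  have indep: "integrable M (\<lambda>\<omega>. A k \<omega> * h (X i \<omega>)) \<and>
      expectation (\<lambda>\<omega>. A k \<omega> * h (X i \<omega>)) = expectation (A k) * expectation (\<lambda>\<omega>. h (X i \<omega>))"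
    if [measurable]: "h \<in> borel_measurable borel" and "integrable M (\<lambda>\<omega>. h (X i \<omega>))" for h k
  proof -
    \<comment> \<open>As \<open>i\<close> is not in \<open>I\<close>, the two functions depend on
      disjoint blocks of independent coordinates.\<close>
    have "indep_var borel
        ((\<lambda>x. (\<Prod>j\<in>I. f j (x j)) * (\<Sum>j\<in>I. g j (x j)) ^ k) \<circ> (\<lambda>\<omega>. restrict (\<lambda>j. X j \<omega>) I))
        borel ((\<lambda>x. h (x i)) \<circ> (\<lambda>\<omega>. restrict (\<lambda>j. X j \<omega>) {i}))"
      using insert.hyps by (intro indep_var_compose[OF indep_var_restrict[OF insert.prems(1)]]) auto
    also have "(\<lambda>x. (\<Prod>j\<in>I. f j (x j)) * (\<Sum>j\<in>I. g j (x j)) ^ k) \<circ> (\<lambda>\<omega>. restrict (\<lambda>j. X j \<omega>) I) = A k"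
      by (auto simp: A_def W_def S_def fun_eq_iff)
    also have "(\<lambda>x. h (x i)) \<circ> (\<lambda>\<omega>. restrict (\<lambda>j. X j \<omega>) {i}) = (\<lambda>\<omega>. h (X i \<omega>))"
      by auto
    finally show ?thesis
      using IH that indep_var_lebesgue_integral indep_var_integrable by blast
  qed
  note indep_f = indep[OF f int_f]
  have "(\<lambda>x. g i x ^ k) \<in> borel_measurable borel" for k by measurable
  note indep_g = indep[OF this int_g]
  have W_insert: "W (insert i I) \<omega> = W I \<omega> * ?w \<omega>" for \<omega>
    using insert.hyps by (simp add: W_def mult.commute)
  have S_insert: "S (insert i I) \<omega> = S I \<omega> + ?z \<omega>" for \<omega>
    using insert.hyps by (simp add: S_def)
  have fg_power: "?w \<omega> * ?z \<omega> ^ Suc k = ?z \<omega> ^ Suc k" for \<omega> k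
    using fg[of i "X i \<omega>"] by (simp flip: mult.assoc)
  \<comment> \<open>By \<open>fg\<close>, every positive power of \<open>?z\<close> absorbs the new
    weight \<open>?w\<close>; only the term free of \<open>?z\<close> keeps it.\<close>
  have expand: "W (insert i I) \<omega> * S (insert i I) \<omega> ^ k
      = A k \<omega> * ?w \<omega> + (\<Sum>j<k. of_nat (k choose Suc j) * (A (k - Suc j) \<omega> * ?z \<omega> ^ Suc j))" for k \<omega>
  proof -
    have "S (insert i I) \<omega> ^ k = (\<Sum>j\<le>k. of_nat (k choose j) * ?z \<omega> ^ j * S I \<omega> ^ (k - j))"
      unfolding S_insert by (subst add.commute) (rule binomial_ring)
    also have "\<dots> = S I \<omega> ^ k + (\<Sum>j<k. of_nat (k choose Suc j) * ?z \<omega> ^ Suc j * S I \<omega> ^ (k - Suc j))"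
      by (simp add: sum.atMost_shift)
    finally have "W (insert i I) \<omega> * S (insert i I) \<omega> ^ k = A k \<omega> * ?w \<omega> +
        (\<Sum>j<k. of_nat (k choose Suc j) * (A (k - Suc j) \<omega> * (?w \<omega> * ?z \<omega> ^ Suc j)))"
      by (simp add: W_insert A_def algebra_simps sum_distrib_left)
    then show ?thesis by (simp only: fg_power)
  qed
  have E_expand: "integrable M (\<lambda>\<omega>. W (insert i I) \<omega> * S (insert i I) \<omega> ^ k) \<and>
      expectation (\<lambda>\<omega>. W (insert i I) \<omega> * S (insert i I) \<omega> ^ k)
      = expectation (A k) * p i +
        (\<Sum>j<k. of_nat (k choose Suc j) * (expectation (A (k - Suc j)) * expectation (\<lambda>\<omega>. ?z \<omega> ^ Suc j)))" for k
  proof -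
    have int: "integrable M (\<lambda>\<omega>. \<Sum>j<k. of_nat (k choose Suc j) * (A (k - Suc j) \<omega> * ?z \<omega> ^ Suc j))"
      using indep_g by (intro Bochner_Integration.integrable_sum integrable_mult_right) blast
    have "expectation (\<lambda>\<omega>. \<Sum>j<k. of_nat (k choose Suc j) * (A (k - Suc j) \<omega> * ?z \<omega> ^ Suc j))
        = (\<Sum>j<k. of_nat (k choose Suc j) * (expectation (A (k - Suc j)) * expectation (\<lambda>\<omega>. ?z \<omega> ^ Suc j)))"
      using indep_g by (subst Bochner_Integration.integral_sum) (simp_all del: power_Suc)
    then show ?thesis
      unfolding expand using indep_f[of k] int insert.prems(2)[of i] by (simp del: power_Suc)
  qed
  have z: "expectation ?z = 0" "expectation (\<lambda>\<omega>. ?z \<omega> ^ 2) = p i * m i 2"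
    "expectation (\<lambda>\<omega>. ?z \<omega> ^ 3) = p i * m i 3" "expectation (\<lambda>\<omega>. ?z \<omega> ^ 4) = p i * m i 4"
    using insert.prems(4)[of i] insert.prems(5)[of i 2] insert.prems(5)[of i 3] insert.prems(5)[of i 4]
    by auto
  have choose: "real (3 choose 2) = 3" "real (4 choose 2) = 6" "real (4 choose 3) = 4"
    by (simp_all add: eval_nat_numeral)
  have lessThan: "{..<Suc 0} = {0::nat}" "{..<2} = {0, 1::nat}" "{..<3} = {0, 1, 2::nat}" "{..<4} = {0, 1, 2, 3::nat}"
    by auto
  have num: "Suc (Suc 0) = 2" "Suc 2 = 3" "Suc 3 = 4" by simp_all
  have E0: "expectation (W (insert i I)) = P * p i"
    using E_expand[of 0] IH by simp
  have E1: "expectation (\<lambda>\<omega>. W (insert i I) \<omega> * S (insert i I) \<omega>) = 0"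
    using E_expand[of 1] IH z by simp
  have E2: "expectation (\<lambda>\<omega>. W (insert i I) \<omega> * S (insert i I) \<omega> ^ 2) = P * p i * (V + m i 2)"
    using conjunct2[OF E_expand[of 2]] IH z by (simp add: lessThan choose num algebra_simps del: power_Suc)
  have E3: "expectation (\<lambda>\<omega>. W (insert i I) \<omega> * S (insert i I) \<omega> ^ 3) = P * p i * (C + m i 3)"
    using conjunct2[OF E_expand[of 3]] IH z by (simp add: lessThan choose num algebra_simps del: power_Suc)
  \<comment> \<open>\<open>A 1\<close> and \<open>?z\<close> have mean zero, so the only surviving
    mixed term is the product of second moments. The term \<open>3 * P * p i * (m i 2)^2\<close>
    added next completes the square.\<close>
  have "expectation (\<lambda>\<omega>. W (insert i I) \<omega> * S (insert i I) \<omega> ^ 4)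
      = expectation (A 4) * p i + 6 * (P * V * (p i * m i 2)) + P * (p i * m i 4)"
    using conjunct2[OF E_expand[of 4]] IH z by (simp add: lessThan choose num algebra_simps del: power_Suc)
  also have "\<dots> \<le> P * (Q + 3 * V\<^sup>2) * p i + 6 * (P * V * (p i * m i 2)) + P * (p i * m i 4) + 3 * P * p i * (m i 2)\<^sup>2"
  proof -
    have "expectation (A 4) * p i \<le> P * (Q + 3 * V\<^sup>2) * p i"
      using IH insert.prems(3)[of i] by (intro mult_right_mono) auto
    moreover have "0 \<le> 3 * P * p i * (m i 2)\<^sup>2"
      using insert.prems(3)[of i] P_nonneg by simp
    ultimately show ?thesis by linarith
  qed
  also have "\<dots> = P * p i * ((Q + m i 4) + 3 * (V + m i 2)\<^sup>2)"
    by algebra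
  finally show ?case
    using E_expand E0 E1 E2 E3 insert.hyps
    by (simp add: P_def V_def C_def Q_def mult.commute add.commute)
qed

section \<open>The quartic test function and its lower bound\<close>

text \<open>The quartic touches the level 0 at 2 and the level 32 at -2. These double roots give one
  factorization for each sign of \<open>y\<close>.\<close>

lemma quartic_le_indicator:
  fixes y :: real
  shows "- (y^4) + y^3 + 8 * y^2 - 12 * y \<le> 32 * of_bool (y \<le> 0)"
proof (cases "y \<le> 0")
  case True
  then have "0 \<le> (y + 2)^2 * (y^2 + (8 - 5 * y))"
    by (intro mult_nonneg_nonneg add_nonneg_nonneg) auto
  also have "\<dots> = 32 - (- (y^4) + y^3 + 8 * y^2 - 12 * y)" by algebra
  finally show ?thesis using True by simp
next
  case False
  then have "0 \<le> y * (y - 2)^2 * (y + 3)" by simp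
  also have "\<dots> = - (- (y^4) + y^3 + 8 * y^2 - 12 * y)" by algebra
  finally show ?thesis using False by simp
qed

text \<open>In \<open>v\<close> the bound is a quadratic with leading coefficient -3, so its minimum
  over an interval is at an end; only two extreme variances need checking.\<close>

lemma quartic_bound_concave:
  assumes "a \<le> v" "v \<le> b" "K \<le> quartic_bound d e a" "K \<le> quartic_bound d e b"
  shows "K \<le> quartic_bound d e v"
proof (cases "a = b")
  case False
  define \<alpha> \<beta> where "\<alpha> = quartic_bound d e 0" and "\<beta> = quartic_bound d e 1 - quartic_bound d e 0 + 3"
  have eq: "quartic_bound d e x = \<alpha> + \<beta> * x - 3 * x^2" for x
    unfolding \<alpha>_def \<beta>_def quartic_bound_def by (simp add: algebra_simps)
  from False assms have ab: "0 < b - a" by simp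
  \<comment> \<open>The last product is the excess of the quadratic over its chord, times
    \<open>b - a\<close>.\<close>
  have "0 \<le> (b - v) * (quartic_bound d e a - K) + (v - a) * (quartic_bound d e b - K)
      + 3 * (v - a) * (b - v) * (b - a)"
    using assms ab by (intro add_nonneg_nonneg mult_nonneg_nonneg) auto
  also have "\<dots> = (b - a) * (quartic_bound d e v - K)"
    unfolding eq by algebra
  finally show ?thesis using ab by (simp add: zero_le_mult_iff)
qed (use assms in auto)

text \<open>The constant 16/3 is 32/6, and \<open>exp d\<close> offsets the factor
  \<open>exp (- d)\<close> that bounds the conditioning probability from below.\<close>

lemma quartic_bound_ge:
  assumes d: "0 \<le> d" "d \<le> 4/3" and e: "0 \<le> e" "e \<le> 2/5"
    and lower: "4/3 - d - e * d \<le> v \<or> e = 2/5 \<and> 0 \<le> v"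
    and upper: "v \<le> (4/3 - d) * (1 + 3/2 * e * d)"
  shows "16/3 * exp d \<le> quartic_bound d e v"
proof -
  define s r where "s = 3/4 * d" and "r = 5/2 * e"
  have sr: "0 \<le> s" "s \<le> 1" "0 \<le> r" "r \<le> 1" "d = 4/3 * s" "e = 2/5 * r"
    using d e by (simp_all add: s_def r_def)
  \<comment> \<open>Halving brings the argument below 1, where \<open>exp x <= 1 + x + x^2\<close>
    applies; \<open>d\<close> itself may reach 4/3.\<close>
  have "exp d = (exp (d/2))^2" by (simp add: exp_double [symmetric])
  also have "\<dots> \<le> (1 + d/2 + (d/2)^2)^2"
    using d by (intro power_mono exp_bound) auto
  finally have "16/3 * exp d \<le> 16/3 * (1 + d/2 + (d/2)^2)^2" by simp
  also have "\<dots> \<le> quartic_bound d e v"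
  proof (rule quartic_bound_concave[OF _ upper])
    let ?K = "16/3 * (1 + d/2 + (d/2)^2)^2"
    show "(if e = 2/5 \<and> 0 \<le> v then 0 else 4/3 - d - e * d) \<le> v"
      using lower by auto
    show "?K \<le> quartic_bound d e (if e = 2/5 \<and> 0 \<le> v then 0 else 4/3 - d - e * d)"
      using quartic_bound_lower[OF sr(1-4)] quartic_bound_zero[OF sr(1,2)]
      unfolding sr(5,6) [symmetric] by (auto simp only: if_True if_False split: if_split)
    show "?K \<le> quartic_bound d e ((4/3 - d) * (1 + 3/2 * e * d))"
      using quartic_bound_upper[OF sr(1-4)] unfolding sr(5,6) [symmetric] .
  qed
  finally show ?thesis .
qed

section \<open>The probability bound at a normalized scale\<close>

text \<open>The two cases of \<open>size_eq\<close> supply the two alternative lower bounds on the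
  variance in \<open>quartic_bound_ge\<close>.\<close>

lemma (in prob_space) small_deviation_normalized:
  fixes U :: "'i \<Rightarrow> 'a \<Rightarrow> real" and e :: real
  assumes I: "finite I" and indep: "indep_vars (\<lambda>_. borel) U I"
    and int: "\<And>i. i \<in> I \<Longrightarrow> integrable M (U i)"
    and mean: "\<And>i. i \<in> I \<Longrightarrow> expectation (U i) = 0"
    and lower: "\<And>i. i \<in> I \<Longrightarrow> AE \<omega> in M. - e \<le> U i \<omega>"
    and e: "0 < e" "e \<le> 2/5"
    and size: "(\<Sum>i\<in>I. expectation (\<lambda>\<omega>. min ((U i \<omega>)\<^sup>2) \<bar>U i \<omega>\<bar>)) \<le> 4/3"
    and size_eq: "(\<Sum>i\<in>I. expectation (\<lambda>\<omega>. min ((U i \<omega>)\<^sup>2) \<bar>U i \<omega>\<bar>)) = 4/3 \<or> e = 2/5"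
  shows "1/6 \<le> \<P>(\<omega> in M. (\<Sum>i\<in>I. U i \<omega>) \<le> e)"
proof -
  define w :: "real \<Rightarrow> real" where "w = indicator {-e..1}"
  define p d t where "p i = expectation (\<lambda>\<omega>. w (U i \<omega>))"
    and "d i = - expectation (\<lambda>\<omega>. w (U i \<omega>) * U i \<omega>) / p i"
    and "t i = expectation (\<lambda>\<omega>. min ((U i \<omega>)\<^sup>2) \<bar>U i \<omega>\<bar>)" for i
  define g where "g i x = w x * (x + d i)" for i x
  define m where "m i k = expectation (\<lambda>\<omega>. g i (U i \<omega>) ^ k) / p i" for i k
  have trunc: "0 < p i" "1 \<le> p i * (1 + d i)" "0 \<le> d i" "d i \<le> e"
      "expectation (\<lambda>\<omega>. g i (U i \<omega>)) = 0" "0 \<le> m i 2"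
      "t i \<le> m i 2 + d i + e * d i" "m i 2 \<le> t i - d i + e * d i" "m i 2 \<le> (1 + e) * (t i - d i)"
      "0 \<le> h \<Longrightarrow> m i 4 \<le> (1 + 4 * h) * m i 3 + e * (1 + 4 * h + e) * m i 2"
    if "i \<in> I" for i h
    using truncated_moments[OF int[OF that] mean[OF that] lower[OF that] e(1),
        folded w_def, folded p_def, folded d_def, folded g_def, folded m_def t_def] e(2)
    by (force+)
  have w_le: "\<bar>w x\<bar> \<le> 1" for x by (simp add: w_def indicator_def)
  have g_le: "\<bar>g i x\<bar> \<le> 1 + \<bar>d i\<bar>" for i x using e by (auto simp: g_def w_def indicator_def)
  have wg: "w x * g i x = g i x" for i x by (simp add: g_def w_def indicator_def)
  have w_meas: "w \<in> borel_measurable borel" unfolding w_def by measurable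
  then have g_meas: "g i \<in> borel_measurable borel" for i unfolding g_def by measurable
  define W S where "W \<omega> = (\<Prod>i\<in>I. w (U i \<omega>))" and "S \<omega> = (\<Sum>i\<in>I. g i (U i \<omega>))" for \<omega>
  define P D V C Q \<theta> where "P = (\<Prod>i\<in>I. p i)" and "D = (\<Sum>i\<in>I. d i)" and "V = (\<Sum>i\<in>I. m i 2)"
    and "C = (\<Sum>i\<in>I. m i 3)" and "Q = (\<Sum>i\<in>I. m i 4)" and "\<theta> = D + e"
  have moments: "integrable M (\<lambda>\<omega>. W \<omega> * S \<omega> ^ k)" "expectation W = P"
    "expectation (\<lambda>\<omega>. W \<omega> * S \<omega>) = 0" "expectation (\<lambda>\<omega>. W \<omega> * S \<omega> ^ 2) = P * V"
    "expectation (\<lambda>\<omega>. W \<omega> * S \<omega> ^ 3) = P * C"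
    "expectation (\<lambda>\<omega>. W \<omega> * S \<omega> ^ 4) \<le> P * (Q + 3 * V\<^sup>2)" for k
  proof -
    have "expectation (\<lambda>\<omega>. g i (U i \<omega>) ^ k) = p i * m i k" if "i \<in> I" for i k
      using trunc(1)[OF that] by (simp add: m_def)
    then have "(\<forall>k. integrable M (\<lambda>\<omega>. W \<omega> * S \<omega> ^ k)) \<and> expectation W = P \<and>
        expectation (\<lambda>\<omega>. W \<omega> * S \<omega>) = 0 \<and> expectation (\<lambda>\<omega>. W \<omega> * S \<omega> ^ 2) = P * V \<and>
        expectation (\<lambda>\<omega>. W \<omega> * S \<omega> ^ 3) = P * C \<and>
        expectation (\<lambda>\<omega>. W \<omega> * S \<omega> ^ 4) \<le> P * (Q + 3 * V\<^sup>2)"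
      unfolding W_def [abs_def] S_def P_def V_def C_def Q_def using trunc(1,5)
      by (intro weighted_sum_moments[OF I indep, where f = "\<lambda>_. w" and g = g and B = "\<lambda>i. 1 + \<bar>d i\<bar>"])
         (auto simp: w_meas g_meas w_le g_le wg p_def less_imp_le)
    then show "integrable M (\<lambda>\<omega>. W \<omega> * S \<omega> ^ k)" "expectation W = P"
      "expectation (\<lambda>\<omega>. W \<omega> * S \<omega>) = 0" "expectation (\<lambda>\<omega>. W \<omega> * S \<omega> ^ 2) = P * V"
      "expectation (\<lambda>\<omega>. W \<omega> * S \<omega> ^ 3) = P * C"
      "expectation (\<lambda>\<omega>. W \<omega> * S \<omega> ^ 4) \<le> P * (Q + 3 * V\<^sup>2)"
      by blast+
  qed
  have U_meas [measurable]: "U i \<in> borel_measurable M" if "i \<in> I" for i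
    using int[OF that] by (rule borel_measurable_integrable)

  have D: "0 \<le> D" unfolding D_def using trunc(3) by (intro sum_nonneg)
  then have \<theta>: "0 \<le> \<theta>" using e by (simp add: \<theta>_def)
  have V: "0 \<le> V" unfolding V_def using trunc(6) by (intro sum_nonneg)
  have tV: "sum t I \<le> V + D + e * D"
    using sum_mono[OF trunc(7)] by (simp add: V_def D_def sum.distrib sum_distrib_left)
  have V1: "V \<le> sum t I - D + e * D"
    using sum_mono[OF trunc(8)] by (simp add: V_def D_def sum.distrib sum_subtractf sum_distrib_left)
  have V2: "V \<le> (1 + e) * (sum t I - D)"
    using sum_mono[OF trunc(9)] by (simp add: V_def D_def sum_subtractf flip: sum_distrib_left)
  have Q: "Q \<le> (1 + 4 * \<theta>) * C + e * (1 + 4 * \<theta> + e) * V"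
    using sum_mono[OF trunc(10)[OF _ \<theta>]] by (simp add: V_def C_def Q_def sum.distrib sum_distrib_left)
  have size': "sum t I \<le> 4/3" "sum t I = 4/3 \<or> e = 2/5"
    using size size_eq by (simp_all add: t_def)
  have "0 \<le> (1 + e) * (sum t I - D)" using V V2 by linarith
  then have D_le: "D \<le> 4/3" using e size' by (simp add: zero_le_mult_iff)
  have bound: "16/3 * exp D \<le> quartic_bound D e V"
  proof (rule quartic_bound_ge)
    show "4/3 - D - e * D \<le> V \<or> e = 2/5 \<and> 0 \<le> V" using tV V size' by auto
    have V1': "V \<le> 4/3 - D + e * D" using V1 size' by linarith
    have V2': "V \<le> (1 + e) * (4/3 - D)"
      using e size' by (intro order_trans[OF V2] mult_left_mono) auto
    \<comment> \<open>The two upper bounds are averaged with weights that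
      \<open>0 <= D <= 4/3\<close> makes nonnegative, chosen so that the result has the factor
      \<open>4/3 - D\<close>.\<close>
    have "V = (1 - 3/4 * D) * V + 3/4 * D * V" by algebra
    also have "\<dots> \<le> (1 - 3/4 * D) * (4/3 - D + e * D) + 3/4 * D * ((1 + e) * (4/3 - D))"
      using D D_le V1' V2' by (intro add_mono mult_left_mono) auto
    also have "\<dots> = (4/3 - D) * (1 + 3/2 * e * D)" by algebra
    finally show "V \<le> (4/3 - D) * (1 + 3/2 * e * D)" .
  qed (use D D_le e in auto)

  have "exp (- D) = (\<Prod>i\<in>I. exp (- d i))" by (simp add: D_def exp_sum I sum_negf [symmetric])
  also have "\<dots> \<le> P"
    unfolding P_def
  proof (rule prod_mono, safe)
    fix i assume i: "i \<in> I"
    have "1 \<le> p i * exp (d i)"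
      using trunc(1,2)[OF i] mult_left_mono[OF exp_ge_add_one_self[of "d i"], of "p i"] by linarith
    then show "exp (- d i) \<le> p i" by (simp add: exp_minus field_simps)
  qed auto
  finally have P: "exp (- D) \<le> P" .

  define F where "F y = - (y^4) + y^3 + 8 * y^2 - 12 * y" for y :: real
  \<comment> \<open>These are the coefficients of \<open>F (S - \<theta>)\<close> in powers of
    \<open>S\<close>; the leading one is -1.\<close>
  define c0 c1 c2 c3 where "c0 = 12 * \<theta> + 8 * \<theta>^2 - \<theta>^3 - \<theta>^4"
    and "c1 = 4 * \<theta>^3 + 3 * \<theta>^2 - 16 * \<theta> - 12" and "c2 = 8 - 3 * \<theta> - 6 * \<theta>^2" and "c3 = 1 + 4 * \<theta>"
  have F: "W \<omega> * F (S \<omega> - \<theta>) = c0 * (W \<omega> * S \<omega> ^ 0) + c1 * (W \<omega> * S \<omega> ^ 1) + c2 * (W \<omega> * S \<omega> ^ 2)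
      + c3 * (W \<omega> * S \<omega> ^ 3) - W \<omega> * S \<omega> ^ 4" for \<omega>
    unfolding F_def c0_def c1_def c2_def c3_def by algebra
  have F_int: "integrable M (\<lambda>\<omega>. W \<omega> * F (S \<omega> - \<theta>))"
    unfolding F using moments(1)
    by (intro Bochner_Integration.integrable_add Bochner_Integration.integrable_diff integrable_mult_right)

  have "1/6 = exp (- D) * (16/3 * exp D) / 32" by (simp add: exp_minus)
  also have "\<dots> \<le> P * quartic_bound D e V / 32"
    using P bound by (intro divide_right_mono mult_mono) (auto intro: order_trans[OF _ P])
  also have "\<dots> \<le> expectation (\<lambda>\<omega>. W \<omega> * F (S \<omega> - \<theta>)) / 32"
  proof -
    \<comment> \<open>The bound on \<open>Q\<close> was taken at \<open>h = \<theta>\<close>, so its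
      factor of \<open>C\<close> is exactly \<open>c3\<close> and the third moment cancels, whatever
      its sign.\<close>
    have "P * quartic_bound D e V = P * (c0 + c2 * V + c3 * C - (c3 * C + e * (c3 + e) * V + 3 * V^2))"
      unfolding quartic_bound_def \<theta>_def [symmetric] c0_def c2_def c3_def by algebra
    also have "\<dots> \<le> P * (c0 + c2 * V + c3 * C - (Q + 3 * V^2))"
      using Q order_trans[OF _ P, of 0] by (intro mult_left_mono) (auto simp: c3_def)
    also have "\<dots> \<le> expectation (\<lambda>\<omega>. W \<omega> * F (S \<omega> - \<theta>))"
      unfolding F
      using moments(2-6) moments(1)[of 0] moments(1)[of 1] moments(1)[of 2] moments(1)[of 3] moments(1)[of 4]
      by (simp add: algebra_simps)
    finally show ?thesis by simp
  qed
  also have "\<dots> \<le> expectation (\<lambda>\<omega>. 32 * indicator {\<omega> \<in> space M. (\<Sum>i\<in>I. U i \<omega>) \<le> e} \<omega>) / 32"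
  proof (intro divide_right_mono integral_mono F_int)
    fix \<omega> assume \<omega>: "\<omega> \<in> space M"
    show "W \<omega> * F (S \<omega> - \<theta>) \<le> 32 * indicator {\<omega> \<in> space M. (\<Sum>i\<in>I. U i \<omega>) \<le> e} \<omega>"
    \<comment> \<open>If no variable leaves the window, \<open>S - \<theta>\<close> is the sum of
      the \<open>U i\<close> minus \<open>e\<close>; otherwise \<open>W\<close> vanishes.\<close>
    proof (cases "\<forall>i\<in>I. U i \<omega> \<in> {-e..1}")
      case True
      then have "W \<omega> = 1" "S \<omega> = (\<Sum>i\<in>I. U i \<omega>) + D"
        by (simp_all add: W_def S_def g_def w_def D_def sum.distrib)
      then show ?thesis
        using quartic_le_indicator[of "S \<omega> - \<theta>"] \<omega>
        by (auto simp: F_def \<theta>_def indicator_def of_bool_def)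
    next
      case False
      then obtain i where "i \<in> I" "w (U i \<omega>) = 0" by (auto simp: w_def)
      then have "W \<omega> = 0" using I by (auto simp: W_def)
      then show ?thesis by simp
    qed
  qed (auto simp: emeasure_eq_measure)
  also have "\<dots> = \<P>(\<omega> in M. (\<Sum>i\<in>I. U i \<omega>) \<le> e)" by simp
  finally show ?thesis .
qed

section \<open>Choice of the scale by continuity\<close>

text \<open>The function is the square up to 1, with slope at most 2, and the identity beyond, with
  slope 1.\<close>

lemma min_square_lipschitz:
  fixes a b :: real
  assumes "0 \<le> a" "0 \<le> b"
  shows "\<bar>min (a\<^sup>2) a - min (b\<^sup>2) b\<bar> \<le> 2 * \<bar>a - b\<bar>"
proof -
  have *: "\<bar>min (a\<^sup>2) a - min (b\<^sup>2) b\<bar> \<le> 2 * \<bar>a - b\<bar>" if "0 \<le> a" "a \<le> b" for a b :: real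
  proof -
    have min: "min (x\<^sup>2) x = (if x \<le> 1 then x\<^sup>2 else x)" if "0 \<le> x" for x :: real
      using that mult_left_mono[of x 1 x] mult_left_mono[of 1 x x] by (auto simp: power2_eq_square min_def)
    have "a\<^sup>2 \<le> b\<^sup>2" using that by (intro power_mono)
    moreover have "b\<^sup>2 - a\<^sup>2 \<le> 2 * (b - a)" if "b \<le> 1"
      using mult_left_mono[of "a + b" 2 "b - a"] \<open>a \<le> b\<close> that by (simp add: power2_eq_square algebra_simps)
    moreover have "a\<^sup>2 \<le> a \<and> a - a\<^sup>2 \<le> 1 - a" if "a \<le> 1"
      using mult_left_mono[of a 1 a] zero_le_power2[of "1 - a"] \<open>0 \<le> a\<close> that
      by (simp add: power2_eq_square algebra_simps)
    ultimately show ?thesis using that min[of a] min[of b] by (auto split: if_splits)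
  qed
  show ?thesis using *[of a b] *[of b a] assms by (cases "a \<le> b") (auto simp: abs_minus_commute)
qed

text \<open>The integral is Lipschitz in \<open>e\<close> with constant twice the first absolute
  moment, so no second moment has to exist.\<close>

lemma continuous_on_expectation_min_square:
  fixes X :: "'a \<Rightarrow> real"
  assumes X: "integrable M X"
  shows "continuous_on UNIV (\<lambda>e. \<integral>\<omega>. min ((e * X \<omega>)\<^sup>2) \<bar>e * X \<omega>\<bar> \<partial>M)"
proof -
  define \<phi> where "\<phi> e \<omega> = min ((e * X \<omega>)\<^sup>2) \<bar>e * X \<omega>\<bar>" for e \<omega>
  have [measurable]: "X \<in> borel_measurable M" using X by (rule borel_measurable_integrable)
  have int: "integrable M (\<phi> e)" for e
    unfolding \<phi>_def [abs_def]
    by (rule Bochner_Integration.integrable_bound[where f = "\<lambda>\<omega>. e * X \<omega>"]) (use X in auto)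
  have \<phi>_diff: "\<bar>\<phi> a \<omega> - \<phi> b \<omega>\<bar> \<le> 2 * \<bar>a - b\<bar> * \<bar>X \<omega>\<bar>" for a b \<omega>
  proof -
    have "\<bar>\<phi> a \<omega> - \<phi> b \<omega>\<bar> \<le> 2 * abs (\<bar>a * X \<omega>\<bar> - \<bar>b * X \<omega>\<bar>)"
      using min_square_lipschitz[of "\<bar>a * X \<omega>\<bar>" "\<bar>b * X \<omega>\<bar>"] unfolding \<phi>_def power2_abs by simp
    also have "\<dots> \<le> 2 * \<bar>a * X \<omega> - b * X \<omega>\<bar>" by (intro mult_left_mono abs_triangle_ineq3) simp
    also have "\<dots> = 2 * \<bar>a - b\<bar> * \<bar>X \<omega>\<bar>" by (simp only: left_diff_distrib [symmetric] abs_mult mult.assoc)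
    finally show ?thesis .
  qed
  have "(2 * (\<integral>\<omega>. \<bar>X \<omega>\<bar> \<partial>M))-lipschitz_on UNIV (\<lambda>e. integral\<^sup>L M (\<phi> e))"
  proof (rule lipschitz_onI)
    fix a b :: real
    have "\<bar>integral\<^sup>L M (\<phi> a) - integral\<^sup>L M (\<phi> b)\<bar> = \<bar>\<integral>\<omega>. \<phi> a \<omega> - \<phi> b \<omega> \<partial>M\<bar>"
      using int by simp
    also have "\<dots> \<le> (\<integral>\<omega>. \<bar>\<phi> a \<omega> - \<phi> b \<omega>\<bar> \<partial>M)"
      by (rule integral_abs_bound)
    also have "\<dots> \<le> (\<integral>\<omega>. 2 * \<bar>a - b\<bar> * \<bar>X \<omega>\<bar> \<partial>M)"
      using X int \<phi>_diff by (intro integral_mono) auto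
    finally show "dist (integral\<^sup>L M (\<phi> a)) (integral\<^sup>L M (\<phi> b)) \<le> 2 * (\<integral>\<omega>. \<bar>X \<omega>\<bar> \<partial>M) * dist a b"
      by (simp add: dist_real_def mult_ac)
  qed simp
  then show ?thesis unfolding \<phi>_def [abs_def] by (rule lipschitz_on_continuous_on)
qed

lemma (in prob_space) small_deviation:
  fixes X :: "'i \<Rightarrow> 'a \<Rightarrow> real"
  assumes I: "finite I" and indep: "indep_vars (\<lambda>_. borel) X I"
    and int: "\<And>i. i \<in> I \<Longrightarrow> integrable M (X i)"
    and mean: "\<And>i. i \<in> I \<Longrightarrow> expectation (X i) = 0"
    and lower: "\<And>i. i \<in> I \<Longrightarrow> AE \<omega> in M. - 1 \<le> X i \<omega>"
  shows "1/6 \<le> \<P>(\<omega> in M. (\<Sum>i\<in>I. X i \<omega>) \<le> 1)"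
proof -
  define h where "h e = (\<Sum>i\<in>I. expectation (\<lambda>\<omega>. min ((e * X i \<omega>)\<^sup>2) \<bar>e * X i \<omega>\<bar>))" for e
  have "continuous_on {0..2/5} h"
    unfolding h_def
    by (intro continuous_on_sum continuous_on_subset[OF continuous_on_expectation_min_square] int) auto
  moreover have "h 0 = 0" by (simp add: h_def)
  \<comment> \<open>If \<open>h\<close> exceeds 4/3 at 2/5, the intermediate value theorem finds a
    scale with value exactly 4/3; otherwise \<open>e = 2/5\<close> is taken.\<close>
  ultimately have "\<exists>e\<ge>0. e \<le> 2/5 \<and> h e = 4/3" if "\<not> h (2/5) \<le> 4/3"
    using IVT'[of h 0 "4/3" "2/5"] that by simp
  then obtain e where e: "0 \<le> e" "e \<le> 2/5" "h e \<le> 4/3" "h e = 4/3 \<or> e = 2/5"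
    by (metis order_refl zero_le_divide_iff zero_le_numeral)
  \<comment> \<open>At \<open>e = 0\<close> both alternatives fail, since
    \<open>h 0 = 0\<close>.\<close>
  have e_pos: "0 < e" using e \<open>h 0 = 0\<close> by (cases "e = 0") auto
  have "1/6 \<le> \<P>(\<omega> in M. (\<Sum>i\<in>I. e * X i \<omega>) \<le> e)"
  proof (rule small_deviation_normalized[OF I])
    show "indep_vars (\<lambda>_. borel) (\<lambda>i \<omega>. e * X i \<omega>) I"
      using indep by (rule indep_vars_compose2) auto
    show "AE \<omega> in M. - e \<le> e * X i \<omega>" if "i \<in> I" for i
      using lower[OF that]
    proof eventually_elim
      case (elim \<omega>)
      then show ?case using mult_left_mono[of "-1" "X i \<omega>" e] e_pos by simp
    qed
  qed (use int mean e e_pos in \<open>auto simp: h_def\<close>)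
  also have "(\<lambda>\<omega>. (\<Sum>i\<in>I. e * X i \<omega>) \<le> e) = (\<lambda>\<omega>. (\<Sum>i\<in>I. X i \<omega>) \<le> 1)"
    using e_pos by (auto simp: fun_eq_iff simp flip: sum_distrib_left)
  finally show ?thesis .
qed

theorem theorem4p2:
  fixes M :: "'a measure" and X :: "nat \<Rightarrow> 'a \<Rightarrow> real" and n :: nat
  assumes "prob_space M"
    and "n \<ge> 1"
    and "prob_space.indep_vars M (\<lambda>_. borel) X {1..n}"
    and "\<And>i. i \<in> {1..n} \<Longrightarrow> integrable M (X i)"
    and "\<And>i. i \<in> {1..n} \<Longrightarrow> (\<integral>\<omega>. X i \<omega> \<partial>M) = 0"
    and "\<And>i. i \<in> {1..n} \<Longrightarrow> AE \<omega> in M. X i \<omega> \<ge> -1"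
  shows "\<P>(\<omega> in M. (\<Sum>i=1..n. X i \<omega>) \<le> 1) \<ge> 0.1541"
proof -
  interpret prob_space M by fact
  have "1/6 \<le> \<P>(\<omega> in M. (\<Sum>i=1..n. X i \<omega>) \<le> 1)"
    using assms by (intro small_deviation) auto
  then show ?thesis by simp
qed

end
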